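(* Let $\mathbb F$ be $\mathbb R$ or $\mathbb C$. For any Denjoy-Carleman class $\mathcal C^M$ there exists $f \in \mathcal C^\infty((-1,1),\mathbb F)$ satisfying: (1) $f \in \mathcal C^M((-1,1),\mathbb F)$; (2) for any Denjoy-Carleman class $\mathcal C^N \subsetneq \mathcal C^M$ and any non-empty open subset $U \subseteq (-1,1)$, $f|_U \notin \mathcal C^N(U,\mathbb F)$.
   Context: $\mathbb N$ is the set of non-negative integers. A weight sequence is a non-decreasing sequence $M=(M_n)_{n\ge 0}$ of positive real numbers with $M_0=1$ that is logarithmically convex, i.e. the ratios $M_{n+1}/M_n$ form a non-decreasing sequence; every Denjoy-Carleman class is taken with respect to such a sequence. $\mathcal C^\infty(U,\mathbb F)$ is the algebra of smooth $\mathbb F$-valued functions on an open set $U$. For $U\subseteq\mathbb R^p$ open, $\mathcal C^M(U,\mathbb F)$ is the set of $f\in\mathcal C^\infty(U,\mathbb F)$ such that for every $x\in U$ there are an open $V\subseteq U$ containing $x$ and constants $A,B>0$ with $|D^\alpha f(y)|\le A B^{|\alpha|}|\alpha|!\,M_{|\alpha|}$ for all $\alpha\in\mathbb N^p$ and all $y\in V$. The class $\mathcal C^M$ determined in this way is called a Denjoy-Carleman class. One writes $\mathcal C^N\subseteq\mathcal C^M$ if $\sup_{n\ge1}(N_n/M_n)^{1/n}<\infty$ (this is equivalent to $\mathcal C^N(U,\mathbb F)\subseteq\mathcal C^M(U,\mathbb F)$), and $\mathcal C^N\subsetneq\mathcal C^M$ if $\mathcal C^N\subseteq\mathcal C^M$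 but not $\mathcal C^M\subseteq\mathcal C^N$. *)

theory Defs
  imports "HOL-Analysis.Analysis"
begin

definition weight_sequence :: "(nat \<Rightarrow> real) \<Rightarrow> bool" where
  "weight_sequence M \<longleftrightarrow>
     M 0 = 1 \<and> (\<forall>n. 0 < M n) \<and> incseq M \<and> incseq (\<lambda>n. M (Suc n) / M n)"

text \<open>
  Functions on an open set \<open>U\<close> of reals are represented by total functions on the reals.
  Everything below depends only on the values on the open set \<open>U\<close>, so the restriction of
  \<open>f\<close> to an open subset is represented by \<open>f\<close> itself. In dimension one a
  multi-index is a natural number and \<open>D\<^sup>\<alpha>\<close> is the iterated derivative.
\<close>

definition nth_derivative :: "nat \<Rightarrow> (real \<Rightarrow> 'a::real_normed_vector) \<Rightarrow> real \<Rightarrow> 'a" where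
  "nth_derivative n f = ((\<lambda>g x. vector_derivative g (at x)) ^^ n) f"

definition smooth_functions :: "real set \<Rightarrow> (real \<Rightarrow> 'a::real_normed_vector) set" where
  "smooth_functions U = {f. \<forall>n. \<forall>x\<in>U. nth_derivative n f differentiable (at x)}"

definition denjoy_carleman ::
    "(nat \<Rightarrow> real) \<Rightarrow> real set \<Rightarrow> (real \<Rightarrow> 'a::real_normed_vector) set" where
  "denjoy_carleman M U =
     {f \<in> smooth_functions U.
        \<forall>x\<in>U. \<exists>V A B. open V \<and> V \<subseteq> U \<and> x \<in> V \<and> 0 < A \<and> 0 < B \<and>
          (\<forall>n. \<forall>y\<in>V. norm (nth_derivative n f y) \<le> A * B ^ n * fact n * M n)}"

definition dc_subset :: "(nat \<Rightarrow> real) \<Rightarrow> (nat \<Rightarrow> real) \<Rightarrow> bool" where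
  "dc_subset N M \<longleftrightarrow> bdd_above ((\<lambda>n. root n (N n / M n)) ` {1..})"

definition dc_psubset :: "(nat \<Rightarrow> real) \<Rightarrow> (nat \<Rightarrow> real) \<Rightarrow> bool" where
  "dc_psubset N M \<longleftrightarrow> dc_subset N M \<and> \<not> dc_subset M N"

end

theory Submission
  imports Defs
begin

text \<open>
  With \<open>m n = n! M n\<close> the function is a lacunary cosine series \<open>\<Sum>j. a j * cos (2 ^ j * x)\<close> whose
  coefficients are the Legendre-type transform \<open>a j = inf\<^sub>l m l / 2 ^ (j * l)\<close>, kept only for those \<open>j\<close>
  for which some ratio \<open>m (n + 1) / m n\<close> lies in \<open>[2 ^ j, 2 ^ (j + 1))\<close>. Log-convexity makes the
  \<open>n\<close>-th derivative of size at most \<open>5 * m n\<close>, while one of its terms has amplitude at least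
  \<open>m n / 2 ^ n\<close>. A difference operator of order about \<open>2 * n\<close> with step \<open>pi\<close> over the frequency of that
  term isolates it, which shows that the \<open>n\<close>-th derivative exceeds \<open>m n / 2 ^ (n + 1)\<close> somewhere on
  every interval of length about \<open>n * m n / m (n + 1)\<close>. These lengths tend to \<open>0\<close> unless \<open>C\<^sup>M\<close> is the
  analytic class, which contains no strictly smaller class.
\<close>

section \<open>Iterated derivatives\<close>

lemma nth_derivative_eqI:
  assumes "\<And>n x. (g n has_vector_derivative g (Suc n) x) (at x)"
  shows "nth_derivative n (g 0) = g n"
proof (induction n)
  case (Suc n)
  have "nth_derivative (Suc n) (g 0) = (\<lambda>x. vector_derivative (g n) (at x))"
    using Suc by (simp add: nth_derivative_def)
  also have "\<dots> = g (Suc n)"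
    using assms by (intro ext vector_derivative_at)
  finally show ?case .
qed (simp add: nth_derivative_def)

text \<open>The target algebra stays general so that one construction serves both the real and the
  complex field.\<close>

lemma nth_derivative_of_real:
  assumes "\<And>n x. (g n has_real_derivative g (Suc n) x) (at x)"
  shows "nth_derivative n (\<lambda>x. of_real (g 0 x) :: 'a :: real_normed_algebra_1) = (\<lambda>x. of_real (g n x))"
  by (rule nth_derivative_eqI[where g = "\<lambda>n x. of_real (g n x)"])
    (auto intro: has_vector_derivative_of_real assms
      simp: has_real_derivative_iff_has_vector_derivative[symmetric])

section \<open>Iterated differences of cosine series\<close>

definition step_diff :: "real \<Rightarrow> (real \<Rightarrow> real) \<Rightarrow> real \<Rightarrow> real" where
  "step_diff h g x = g x - g (x + h)"

text \<open>The \<open>k\<close>-fold difference combines the values at \<open>x + i * h\<close>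
  with signed binomial coefficients, whose absolute values sum to \<open>2 ^ k\<close>.\<close>

lemma abs_step_diff_funpow_le:
  assumes "h \<ge> 0" "\<And>t. x \<le> t \<Longrightarrow> t \<le> x + k * h \<Longrightarrow> \<bar>g t\<bar> \<le> K"
  shows "\<bar>(step_diff h ^^ k) g x\<bar> \<le> 2 ^ k * K"
  using assms(2)
proof (induction k arbitrary: x)
  case (Suc k)
  have "\<bar>(step_diff h ^^ k) g x\<bar> \<le> 2 ^ k * K"
    using assms(1) by (intro Suc.IH Suc.prems) (auto simp: algebra_simps)
  moreover have "\<bar>(step_diff h ^^ k) g (x + h)\<bar> \<le> 2 ^ k * K"
    using assms(1) by (intro Suc.IH Suc.prems) (auto simp: algebra_simps)
  ultimately show ?case by (simp add: step_diff_def[of h "(step_diff h ^^ k) g"])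
qed simp

text \<open>Keeping a cosine on the right makes the identity iterable. When
  \<open>l * h = pi\<close> the phase shift vanishes and the factor is \<open>2\<close>.\<close>

lemma cos_diff_shift:
  fixes x l h c :: real
  shows "cos (l * x + c) - cos (l * (x + h) + c) =
    2 * sin (l * h / 2) * cos (l * x + c + (l * h / 2 - pi / 2))"
proof -
  have "cos (l * x + c + (l * h / 2 - pi / 2)) = sin (l * x + c + l * h / 2)"
    using sin_cos_eq[of "l * x + c + l * h / 2"] cos_minus[of "l * x + c + l * h / 2 - pi / 2"]
    by (simp add: algebra_simps)
  moreover have "cos (l * x + c) - cos (l * (x + h) + c) =
      2 * sin (l * x + c + l * h / 2) * sin (l * h / 2)"
    unfolding cos_diff_cos by (simp add: field_simps)
  ultimately show ?thesis by simp
qed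

lemma sums_step_diff_funpow_cos:
  assumes "\<And>x. (\<lambda>j. b j * cos (l j * x + c)) sums g x"
  shows "(\<lambda>j. b j * (2 * sin (l j * h / 2)) ^ k * cos (l j * x + c + k * (l j * h / 2 - pi / 2)))
    sums (step_diff h ^^ k) g x"
proof (induction k arbitrary: x)
  case (Suc k)
  have eq: "b j * (2 * sin (l j * h / 2)) ^ Suc k * cos (l j * x + c + Suc k * (l j * h / 2 - pi / 2))
    = b j * (2 * sin (l j * h / 2)) ^ k * cos (l j * x + c + k * (l j * h / 2 - pi / 2))
    - b j * (2 * sin (l j * h / 2)) ^ k * cos (l j * (x + h) + c + k * (l j * h / 2 - pi / 2))"
    (is "?l = ?B * cos ?u - ?B * cos ?v") for j
  proof -
    let ?w = "l j * h / 2 - pi / 2"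
    have "cos ?u - cos ?v = 2 * sin (l j * h / 2) * cos (l j * x + (c + k * ?w) + ?w)"
      using cos_diff_shift[of "l j" x "c + k * ?w" h] by (simp only: add.assoc)
    moreover have "l j * x + (c + k * ?w) + ?w = l j * x + c + Suc k * ?w"
      by (simp only: of_nat_Suc distrib_right mult_1_left add_ac)
    ultimately have "?l = ?B * (cos ?u - cos ?v)" by simp
    then show ?thesis by (simp only: right_diff_distrib)
  qed
  show ?case
    unfolding eq using sums_diff[OF Suc[of x] Suc[of "x + h"]]
    by (simp add: step_diff_def[of h "(step_diff h ^^ k) g"])
qed (simp add: assms)

section \<open>Dyadic brackets and geometric sums\<close>

lemma ex_power2_bracket:
  fixes x :: real
  assumes "1 \<le> x"
  shows "\<exists>j. 2 ^ j \<le> x \<and> x < 2 ^ Suc j"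
proof -
  obtain n where n: "x < 2 ^ n"
    using real_arch_pow[of 2 x] by auto
  define k where "k = (LEAST n. x < 2 ^ n)"
  have k: "x < 2 ^ k" unfolding k_def by (rule LeastI[of _ n]) (rule n)
  with assms obtain j where j: "k = Suc j" by (cases k) auto
  have "\<not> x < 2 ^ j" using not_less_Least[of j "\<lambda>n. x < 2 ^ n"] j k_def by auto
  with k j show ?thesis by (intro exI[of _ j]) auto
qed

lemma sum_geometric_tail_le: "(\<Sum>j<K. if J < j then 2 ^ Suc J / 2 ^ j else 0) \<le> (2 :: real)"
proof -
  \<comment> \<open>The right side is the exact partial sum; \<open>max\<close> makes it
    \<open>0\<close> as long as \<open>K \<le> Suc J\<close>.\<close>
  have "(\<Sum>j<K. if J < j then 2 ^ Suc J / 2 ^ j else 0) \<le> (2 - 2 ^ Suc (Suc J) / 2 ^ max K (Suc J) :: real)"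
  proof (induction K)
    case (Suc K)
    show ?case
    proof (cases "J < K")
      case True
      then have "max (Suc K) (Suc J) = Suc K" "max K (Suc J) = K" by auto
      with Suc True show ?thesis by simp
    next
      case False
      then have "max (Suc K) (Suc J) = Suc J" "max K (Suc J) = Suc J" by auto
      with Suc False show ?thesis by simp
    qed
  qed simp
  also have "\<dots> \<le> 2" by simp
  finally show ?thesis .
qed

lemma sum_geometric_head_le: "(\<Sum>j<K. if j \<le> L then 2 ^ j / 2 ^ L else 0) \<le> (2 :: real)"
proof -
  have "(\<Sum>j<K. if j \<le> L then 2 ^ j / 2 ^ L else 0) \<le> (2 ^ min K (Suc L) / 2 ^ L :: real)"
  proof (induction K)
    case (Suc K)
    show ?case
    proof (cases "K \<le> L")
      case True
      then have "min (Suc K) (Suc L) = Suc K" "min K (Suc L) = K" by auto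
      with Suc True show ?thesis by (simp add: field_simps)
    next
      case False
      then have "min (Suc K) (Suc L) = Suc L" "min K (Suc L) = Suc L" by auto
      with Suc False show ?thesis by simp
    qed
  qed simp
  also have "\<dots> \<le> 2 ^ Suc L / 2 ^ L"
    by (intro divide_right_mono power_increasing) auto
  finally show ?thesis by simp
qed

section \<open>Comparison of weight sequences\<close>

lemma weight_sequence_ge_1: "weight_sequence M \<Longrightarrow> 1 \<le> M n"
  unfolding weight_sequence_def by (metis incseqD zero_le)

text \<open>For \<open>n \<ge> 1\<close> the \<open>n\<close>-th root of \<open>A\<close> is at most
  \<open>max 1 A\<close>, and the finitely many indices below \<open>n0\<close> cannot spoil
  boundedness.\<close>

lemma dc_subsetI:
  assumes "weight_sequence M" "weight_sequence N"
    and "0 < A" "0 < B" "\<And>n. n0 \<le> n \<Longrightarrow> M n \<le> A * B ^ n * N n"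
  shows "dc_subset M N"
proof -
  define C where "C = max 1 A * B"
  have "root n (M n / N n) \<le> C" if "n0 \<le> n" "1 \<le> n" for n
  proof -
    have N: "0 < N n" using assms(2) by (auto simp: weight_sequence_def)
    have "A \<le> max 1 A ^ n"
      using self_le_power[of "max 1 A" n] that by linarith
    then have "A * B ^ n \<le> C ^ n"
      using assms(4) by (simp add: C_def power_mult_distrib)
    then have "M n / N n \<le> C ^ n"
      using assms(5)[OF that(1)] N by (simp add: divide_simps) (smt (verit) mult_right_mono)
    then have "root n (M n / N n) \<le> root n (C ^ n)"
      using that by (intro real_root_le_mono) auto
    then show ?thesis
      using that assms(4) by (simp add: real_root_power_cancel C_def)
  qed
  then have "bdd_above ((\<lambda>n. root n (M n / N n)) ` {max 1 n0..})"
    by (intro bdd_aboveI2[of _ _ C]) auto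
  moreover have "bdd_above ((\<lambda>n. root n (M n / N n)) ` {1..<n0})"
    by (intro bdd_above_finite) auto
  ultimately have "bdd_above ((\<lambda>n. root n (M n / N n)) ` ({1..<n0} \<union> {max 1 n0..}))"
    unfolding image_Un by simp
  then show ?thesis
    unfolding dc_subset_def by (rule bdd_above_mono) auto
qed

section \<open>The lacunary series of a weight sequence\<close>

locale weight =
  fixes M :: "nat \<Rightarrow> real"
  assumes weight_sequence: "weight_sequence M"
begin

definition m :: "nat \<Rightarrow> real" where
  "m n = fact n * M n"

text \<open>This is \<open>m (Suc n) / m n\<close>, written as a product of two non-decreasing
  factors.\<close>

definition mu :: "nat \<Rightarrow> real" where
  "mu n = real (Suc n) * (M (Suc n) / M n)"

definition J :: "nat \<Rightarrow> nat" where
  "J n = (SOME j. 2 ^ j \<le> mu n \<and> mu n < 2 ^ Suc j)"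

definition a :: "nat \<Rightarrow> real" where
  "a j = (if j \<in> range J then INF l. m l / (2 ^ j) ^ l else 0)"

text \<open>The termwise \<open>n\<close>-th derivative of \<open>g 0\<close>: differentiating a
  cosine advances its phase by \<open>pi / 2\<close>.\<close>

definition g :: "nat \<Rightarrow> real \<Rightarrow> real" where
  "g n x = (\<Sum>j. a j * (2 ^ j) ^ n * cos (2 ^ j * x + n * (pi / 2)))"

lemma M_pos: "0 < M n" and M_incseq: "incseq M"
  and ratio_incseq: "incseq (\<lambda>n. M (Suc n) / M n)"
  using weight_sequence by (auto simp: weight_sequence_def)

lemma m_pos: "0 < m n"
  by (simp add: m_def M_pos)

lemma m_Suc: "m (Suc n) = mu n * m n"
  using M_pos[of n] by (simp add: m_def mu_def)

lemma ratio_ge_1: "1 \<le> M (Suc n) / M n"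
  using M_pos[of n] incseqD[OF M_incseq, of n "Suc n"] by simp

lemma mu_ge_1: "1 \<le> mu n"
  using mult_mono[of 1 "real (Suc n)" 1 "M (Suc n) / M n"] ratio_ge_1 by (simp add: mu_def)

lemma mu_pos: "0 < mu n"
  using mu_ge_1[of n] by linarith

lemma mu_mono: "i \<le> n \<Longrightarrow> mu i \<le> mu n"
  unfolding mu_def using ratio_ge_1[of i] incseqD[OF ratio_incseq, of i n]
  by (intro mult_mono) auto

lemma J_bounds: "2 ^ J n \<le> mu n" "mu n < 2 ^ Suc (J n)"
  using someI_ex[OF ex_power2_bracket[OF mu_ge_1[of n]]] unfolding J_def by auto

lemma J_mono: "i \<le> n \<Longrightarrow> J i \<le> J n"
proof -
  assume "i \<le> n"
  then have "(2 :: real) ^ J i < 2 ^ Suc (J n)"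
    using J_bounds(1)[of i] J_bounds(2)[of n] mu_mono by force
  then show "J i \<le> J n" by (simp del: power_Suc)
qed

lemma m_add_ge: "m n * mu n ^ d \<le> m (n + d)"
proof (induction d)
  case (Suc d)
  have "m n * mu n ^ Suc d = (m n * mu n ^ d) * mu n" by simp
  also have "\<dots> \<le> m (n + d) * mu (n + d)"
    using Suc mu_pos[of n] mu_mono[of n "n + d"] m_pos[of "n + d"] by (intro mult_mono) auto
  finally show ?case by (simp add: m_Suc mult.commute)
qed simp

text \<open>The \<open>d\<close> ratios leading from \<open>m l\<close> to \<open>m (l + d)\<close>
  have indices below \<open>l + d\<close>, so each is at most \<open>mu (l + d)\<close>.\<close>

lemma m_add_le: "m (l + d) \<le> m l * mu (l + d) ^ d"
proof -
  have "e \<le> d \<Longrightarrow> m (l + e) \<le> m l * mu (l + d) ^ e" for e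
  proof (induction e)
    case (Suc e)
    have "m (l + Suc e) = m (l + e) * mu (l + e)" by (simp add: m_Suc)
    also have "\<dots> \<le> (m l * mu (l + d) ^ e) * mu (l + d)"
      using Suc mu_pos[of "l + e"] mu_pos[of "l + d"] mu_mono[of "l + e" "l + d"] m_pos[of l]
      by (intro mult_mono) auto
    finally show ?case by (simp add: mult_ac)
  qed simp
  then show ?thesis by simp
qed

section \<open>Bounds on the coefficients\<close>

lemma a_nonneg: "0 \<le> a j"
  by (auto simp: a_def intro!: cINF_greatest divide_nonneg_nonneg less_imp_le[OF m_pos])

lemma a_le: "a j * (2 ^ j) ^ l \<le> m l"
proof (cases "j \<in> range J")
  case True
  have "bdd_below (range (\<lambda>l. m l / (2 ^ j) ^ l))"
    by (intro bdd_belowI2[of _ 0] divide_nonneg_nonneg less_imp_le[OF m_pos]) auto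
  then have "a j \<le> m l / (2 ^ j) ^ l"
    using True by (auto simp: a_def intro: cINF_lower)
  then show ?thesis by (simp add: field_simps)
qed (simp add: a_def less_imp_le[OF m_pos])

text \<open>The infimum defining \<open>a (J n)\<close> is nearly attained at \<open>l = n\<close>.
  For \<open>l \<ge> n\<close> the quotients do not drop below the one at \<open>n\<close>, as
  \<open>2 ^ J n \<le> mu n\<close>; for \<open>l < n\<close> the bound
  \<open>mu n < 2 * 2 ^ J n\<close> loses at most \<open>2 ^ n\<close>.\<close>

lemma a_J_ge: "m n / 2 ^ n \<le> a (J n) * (2 ^ J n) ^ n"
proof -
  let ?r = "2 ^ J n :: real"
  have "m n / 2 ^ n / ?r ^ n \<le> m l / ?r ^ l" for l
  proof (cases "n \<le> l")
    case True
    then obtain d where l: "l = n + d" by (auto simp: le_iff_add)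
    have "m n * ?r ^ d \<le> m n * mu n ^ d"
      using J_bounds(1)[of n] m_pos[of n] by (intro mult_left_mono power_mono) auto
    also have "\<dots> \<le> m l" unfolding l by (rule m_add_ge)
    finally have "m n / ?r ^ n \<le> m l / ?r ^ l"
      unfolding l by (simp add: field_simps power_add)
    moreover have "m n / 2 ^ n / ?r ^ n \<le> m n / 1 / ?r ^ n"
      using m_pos[of n] by (intro divide_right_mono divide_left_mono) auto
    ultimately show ?thesis by simp
  next
    case False
    then obtain d where n: "n = l + d" by (metis le_iff_add nle_le)
    have "m n \<le> m l * mu n ^ d" unfolding n by (rule m_add_le)
    also have "\<dots> \<le> m l * (2 * ?r) ^ d"
      using J_bounds(2)[of n] mu_pos[of n] m_pos[of l] by (intro mult_left_mono power_mono) auto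
    also have "\<dots> \<le> m l * (2 ^ n * ?r ^ d)"
      unfolding power_mult_distrib using m_pos[of l] n
      by (intro mult_left_mono mult_right_mono power_increasing) auto
    finally have "m n \<le> m l * (2 ^ n * ?r ^ d)" .
    moreover have "?r ^ n = ?r ^ l * ?r ^ d" by (metis n power_add)
    ultimately show ?thesis by (simp add: field_simps)
  qed
  then have "m n / 2 ^ n / ?r ^ n \<le> a (J n)"
    by (auto simp: a_def intro: cINF_greatest)
  then show ?thesis by (simp add: field_simps)
qed

text \<open>Away from the frequencies comparable to \<open>mu (n - 1)\<close> and \<open>mu n\<close> the terms decay
  geometrically. Restricting to \<open>range J\<close> matters here: between these two values all powers of two
  would contribute \<open>m n\<close> each.\<close>

lemma a_le_geometric:
  "a j * (2 ^ j) ^ n \<le> m n * ((if J n < j then 2 ^ Suc (J n) / 2 ^ j else 0)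
     + (if j = J n then 1 else 0) + (if j \<le> J (n - 1) then 2 ^ j / 2 ^ J (n - 1) else 0))"
proof -
  consider "J n < j" | "j = J n" | "j < J n" "j \<notin> range J" | "j < J n" "j \<in> range J" by force
  then show ?thesis
  proof cases
    case 1
    \<comment> \<open>High frequencies gain a factor \<open>mu n / 2 ^ j\<close> from the bound of
      the next order.\<close>
    have "a j * (2 ^ j) ^ n * 2 ^ j \<le> m n * mu n"
      using a_le[of j "Suc n"] by (simp add: m_Suc mult_ac)
    also have "\<dots> \<le> m n * 2 ^ Suc (J n)"
      using J_bounds(2)[of n] m_pos[of n] by (intro mult_left_mono) auto
    finally have "a j * (2 ^ j) ^ n \<le> m n * (2 ^ Suc (J n) / 2 ^ j)"
      by (simp add: field_simps)
    also have "\<dots> \<le> m n * ((if J n < j then 2 ^ Suc (J n) / 2 ^ j else 0)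
     + (if j = J n then 1 else 0) + (if j \<le> J (n - 1) then 2 ^ j / 2 ^ J (n - 1) else 0))"
      using 1 m_pos[of n] by (intro mult_left_mono) auto
    finally show ?thesis .
  next
    case 2
    have "m n * 1 \<le> m n * ((if J n < j then 2 ^ Suc (J n) / 2 ^ j else 0)
     + (if j = J n then 1 else 0) + (if j \<le> J (n - 1) then 2 ^ j / 2 ^ J (n - 1) else 0))"
      using 2 m_pos[of n] by (intro mult_left_mono) auto
    then show ?thesis using a_le[of j n] by linarith
  next
    case 3
    then show ?thesis using m_pos[of n] by (simp add: a_def)
  next
    case 4
    then obtain i where i: "j = J i" by auto
    with 4 have "i < n" using J_mono[of n i] by force
    then obtain p where n: "n = Suc p" "i \<le> p" by (cases n) auto
    have j: "j \<le> J p" using i n J_mono by auto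
    \<comment> \<open>Low frequencies use the bound of the previous order \<open>p\<close>; here
      \<open>n > 0\<close>, so \<open>n - 1\<close> is not truncated.\<close>
    have "a j * (2 ^ j) ^ n * 2 ^ J p = (a j * (2 ^ j) ^ p) * (2 ^ j * 2 ^ J p)"
      by (simp add: n)
    also have "\<dots> \<le> m p * (2 ^ j * mu p)"
      using a_le[of j p] J_bounds(1)[of p] m_pos[of p] by (intro mult_mono) auto
    also have "\<dots> = m n * 2 ^ j" by (simp add: n m_Suc)
    finally have "a j * (2 ^ j) ^ n \<le> m n * (2 ^ j / 2 ^ J p)"
      by (simp add: field_simps)
    then show ?thesis using 4 j n by simp
  qed
qed

text \<open>The tail, the peak and the head contribute \<open>2\<close>, \<open>1\<close> and
  \<open>2\<close>.\<close>

lemma sum_a_le: "(\<Sum>j<K. a j * (2 ^ j) ^ n) \<le> 5 * m n"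
proof -
  have "(\<Sum>j<K. a j * (2 ^ j) ^ n) \<le> m n * ((\<Sum>j<K. if J n < j then 2 ^ Suc (J n) / 2 ^ j else 0)
     + (\<Sum>j<K. if j = J n then 1 else 0) + (\<Sum>j<K. if j \<le> J (n - 1) then 2 ^ j / 2 ^ J (n - 1) else 0))"
    unfolding sum.distrib[symmetric] sum_distrib_left by (intro sum_mono a_le_geometric)
  also have "\<dots> \<le> m n * (2 + 1 + 2)"
    using m_pos[of n]
    by (intro mult_left_mono add_mono sum_geometric_tail_le sum_geometric_head_le) auto
  finally show ?thesis by simp
qed

section \<open>Termwise differentiation and membership in the class\<close>

lemma summable_a: "summable (\<lambda>j. a j * (2 ^ j) ^ n)"
  by (rule summableI_nonneg_bounded[where x = "5 * m n"]) (auto simp: a_nonneg sum_a_le)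

lemma term_le: "norm (a j * (2 ^ j) ^ n * cos t) \<le> a j * (2 ^ j) ^ n"
  using mult_left_mono[OF abs_cos_le_one, of "a j * (2 ^ j) ^ n" t]
  by (simp add: abs_mult a_nonneg)

lemma g_sums: "(\<lambda>j. a j * (2 ^ j) ^ n * cos (2 ^ j * x + n * (pi / 2))) sums g n x"
  unfolding g_def by (intro summable_sums summable_comparison_test'[OF summable_a[of n], where N = 0] term_le)

lemma g_le: "\<bar>g n x\<bar> \<le> 5 * m n"
proof -
  have "norm (g n x) \<le> (\<Sum>j. a j * (2 ^ j) ^ n)"
    unfolding g_def by (intro norm_suminf_le term_le summable_a)
  also have "\<dots> \<le> 5 * m n"
    by (intro suminf_le_const summable_a sum_a_le)
  finally show ?thesis by simp
qed

lemma g_has_derivative: "(g n has_real_derivative g (Suc n) x) (at x)"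
proof -
  let ?f = "\<lambda>n j x. a j * (2 ^ j) ^ n * cos (2 ^ j * x + real n * (pi / 2))"
  have cos: "cos (t + Suc n * (pi / 2)) = - sin (t + n * (pi / 2))" for t
    using minus_sin_cos_eq[of "t + n * (pi / 2)"] by (simp add: field_simps)
  have "(?f n j has_field_derivative ?f (Suc n) j x) (at x within UNIV)" for j x
    unfolding cos by (auto intro!: derivative_eq_intros)
  \<comment> \<open>Uniform convergence of the differentiated series permits termwise
    differentiation.\<close>
  moreover have "uniformly_convergent_on UNIV (\<lambda>k x. \<Sum>j<k. ?f (Suc n) j x)"
    by (intro Weierstrass_m_test'[OF _ summable_a[of "Suc n"]] term_le)
  ultimately have "((\<lambda>x. \<Sum>j. ?f n j x) has_field_derivative (\<Sum>j. ?f (Suc n) j x)) (at x)"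
    using has_field_derivative_series'(2)[where S = UNIV and f = "?f n" and f' = "?f (Suc n)" and ?x0.0 = x and x = x]
      sums_summable[OF g_sums] by simp
  then show ?thesis by (simp only: g_def[abs_def])
qed

lemma nth_derivative_g:
  "nth_derivative n (\<lambda>x. of_real (g 0 x) :: 'a :: real_normed_algebra_1) = (\<lambda>x. of_real (g n x))"
  by (rule nth_derivative_of_real) (rule g_has_derivative)

lemma g_in_smooth_functions:
  "(\<lambda>x. of_real (g 0 x) :: 'a :: real_normed_algebra_1) \<in> smooth_functions U"
  unfolding smooth_functions_def mem_Collect_eq nth_derivative_g
  by (auto intro!: differentiableI_vector has_vector_derivative_of_real
      g_has_derivative simp: has_real_derivative_iff_has_vector_derivative[symmetric])

lemma g_in_denjoy_carleman:
  assumes "open U"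
  shows "(\<lambda>x. of_real (g 0 x) :: 'a :: real_normed_algebra_1) \<in> denjoy_carleman M U"
  unfolding denjoy_carleman_def mem_Collect_eq nth_derivative_g norm_of_real
proof (intro conjI g_in_smooth_functions ballI)
  fix x assume "x \<in> U"
  have "\<bar>g n y\<bar> \<le> 5 * 1 ^ n * fact n * M n" for n y
    using g_le[of n y] by (simp add: m_def mult.assoc)
  with assms \<open>x \<in> U\<close> show "\<exists>V A B. open V \<and> V \<subseteq> U \<and> x \<in> V \<and> 0 < A \<and> 0 < B \<and>
      (\<forall>n. \<forall>y\<in>V. \<bar>g n y\<bar> \<le> A * B ^ n * fact n * M n)"
    by (intro exI[of _ U] exI[of _ "5 :: real"] exI[of _ "1 :: real"]) auto
qed

section \<open>Exclusion from strictly smaller classes\<close>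

text \<open>A difference operator of order \<open>2 * (n + 4)\<close> with step \<open>pi / 2 ^ J n\<close> annihilates the
  frequencies above \<open>2 ^ J n\<close> and multiplies that frequency by \<open>2\<close> each time, but every lower
  frequency only by at most \<open>sqrt 2\<close>, so the term with frequency \<open>2 ^ J n\<close> dominates the result.\<close>

lemma g_lower_bound:
  assumes K: "\<And>t. x \<le> t \<Longrightarrow> t \<le> x + real (2 * n + 9) * (pi / 2 ^ J n) \<Longrightarrow> \<bar>g n t\<bar> \<le> K"
  shows "m n \<le> 2 * 2 ^ n * K"
proof -
  define h where "h = pi / 2 ^ J n"
  \<comment> \<open>The relative gain \<open>2 ^ q = 16 * 2 ^ n\<close> must beat the loss
    \<open>2 ^ n\<close> in \<open>a_J_ge\<close> and the constant \<open>5\<close> in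
    \<open>sum_a_le\<close>.\<close>
  define q where "q = n + 4"
  define s where "s j = 2 * sin (2 ^ j * h / 2)" for j
  \<comment> \<open>Rounding moves \<open>x\<close> by at most \<open>h\<close> to a point
    \<open>y\<close> where the phase of the dominant term is an integer multiple of
    \<open>pi\<close>, so its cosine is \<open>1\<close> or \<open>-1\<close>.\<close>
  define z where "z = of_int \<lceil>x / h + n / 2\<rceil> - real n / 2"
  define y where "y = h * z"
  define b where "b j = a j * (2 ^ j) ^ n" for j
  define c where "c j = cos (2 ^ j * y + n * (pi / 2) + (2 * q) * (2 ^ j * h / 2 - pi / 2))" for j
  have h: "h > 0" by (simp add: h_def)
  have "x / h \<le> z" "z \<le> x / h + 1" unfolding z_def by linarith+
  then have "x \<le> y" "y \<le> x + h"
    using h by (simp_all add: y_def field_simps)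
  have sums: "(\<lambda>j. b j * s j ^ (2 * q) * c j) sums (step_diff h ^^ (2 * q)) (g n) y"
    using sums_step_diff_funpow_cos[OF g_sums, of n h "2 * q" y] by (simp add: b_def s_def c_def)
  have s_high: "s j = 0" if "J n < j" for j
  proof -
    from that obtain d where "j = Suc (J n + d)" by (metis less_iff_Suc_add)
    then have "2 ^ j * h / 2 = of_nat (2 ^ d) * pi" by (simp add: h_def power_add)
    then show ?thesis unfolding s_def by (simp only: sin_npi)
  qed
  have s_low: "\<bar>s j\<bar> ^ (2 * q) \<le> 2 ^ q" if "j < J n" for j
  proof -
    from that obtain d where "J n = Suc (j + d)" by (metis less_iff_Suc_add)
    then have eq: "2 ^ j * h / 2 = pi / 4 / 2 ^ d" by (simp add: h_def power_add)
    have "pi / 4 / 2 ^ d \<le> pi / 4 / 1" by (intro divide_left_mono) auto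
    then have "sin (pi / 4 / 2 ^ d) \<le> sin (pi / 4)" by (intro sin_monotone_2pi_le) (auto intro: order.trans[of _ 0])
    moreover have "pi / 4 / 2 ^ d \<le> pi"
      using \<open>pi / 4 / 2 ^ d \<le> pi / 4 / 1\<close> pi_gt_zero by linarith
    then have "0 \<le> sin (pi / 4 / 2 ^ d)" by (intro sin_ge_zero) auto
    ultimately have "\<bar>s j\<bar> \<le> sqrt 2" unfolding s_def eq by (simp add: sin_45)
    then have "\<bar>s j\<bar> ^ (2 * q) \<le> sqrt 2 ^ (2 * q)" by (intro power_mono) auto
    also have "\<dots> = 2 ^ q" by (simp add: power_mult)
    finally show ?thesis .
  qed
  have "2 ^ J n * h = pi" by (simp add: h_def)
  then have "s (J n) = 2" by (simp add: s_def)
  have "c (J n) = cos (of_int \<lceil>x / h + n / 2\<rceil> * pi)"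
    using \<open>2 ^ J n * h = pi\<close>
    by (simp add: c_def y_def mult.assoc[symmetric]) (simp add: z_def algebra_simps)
  then have c_J: "\<bar>c (J n)\<bar> = 1"
    by (simp add: mult.commute[of _ pi])
  have c_le: "\<bar>c j\<bar> \<le> 1" for j by (simp add: c_def)
  have b: "0 \<le> b j" for j by (simp add: b_def a_nonneg)
  let ?D = "(step_diff h ^^ (2 * q)) (g n) y"
  have "?D = (\<Sum>j\<le>J n. b j * s j ^ (2 * q) * c j)"
    using sums sums_finite[of "{..J n}" "\<lambda>j. b j * s j ^ (2 * q) * c j"] s_high
    by (force simp: q_def intro: sums_unique2)
  also have "\<dots> = (\<Sum>j<J n. b j * s j ^ (2 * q) * c j) + b (J n) * 2 ^ (2 * q) * c (J n)"
    by (simp add: \<open>s (J n) = 2\<close> flip: lessThan_Suc_atMost)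
  finally have D: "?D = \<dots>" .
  have "\<bar>\<Sum>j<J n. b j * s j ^ (2 * q) * c j\<bar> \<le> (\<Sum>j<J n. b j * 2 ^ q)"
  proof (intro order.trans[OF sum_abs] sum_mono)
    fix j assume "j \<in> {..<J n}"
    then have "b j * \<bar>s j\<bar> ^ (2 * q) * \<bar>c j\<bar> \<le> b j * 2 ^ q * 1"
      using b c_le s_low by (intro mult_mono) auto
    then show "\<bar>b j * s j ^ (2 * q) * c j\<bar> \<le> b j * 2 ^ q"
      using b[of j] by (simp add: abs_mult power_abs)
  qed
  also have "\<dots> \<le> 5 * m n * 2 ^ q"
    unfolding sum_distrib_right[symmetric] b_def by (intro mult_right_mono sum_a_le) auto
  finally have low: "\<bar>\<Sum>j<J n. b j * s j ^ (2 * q) * c j\<bar> \<le> 5 * m n * 2 ^ q" .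
  have "\<bar>b (J n) * 2 ^ (2 * q) * c (J n)\<bar> = b (J n) * 2 ^ (2 * q)"
    using b[of "J n"] c_J by (simp add: abs_mult)
  with low D have "b (J n) * 2 ^ (2 * q) - 5 * m n * 2 ^ q \<le> \<bar>?D\<bar>" by linarith
  moreover
  have "\<bar>g n t\<bar> \<le> K" if "y \<le> t" "t \<le> y + real (2 * q) * h" for t
  proof (rule K)
    show "x \<le> t" using \<open>x \<le> y\<close> that by simp
    \<comment> \<open>One step covers the move from \<open>x\<close> to \<open>y\<close>, and
      \<open>2 * q = 2 * n + 8\<close> more serve the differences.\<close>
    have "h + real (2 * q) * h = real (2 * n + 9) * h" by (simp add: q_def algebra_simps)
    with \<open>y \<le> x + h\<close> that show "t \<le> x + real (2 * n + 9) * (pi / 2 ^ J n)"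
      unfolding h_def[symmetric] by linarith
  qed
  then have "\<bar>?D\<bar> \<le> 2 ^ (2 * q) * K"
    using h by (intro abs_step_diff_funpow_le) auto
  moreover have "m n / 2 ^ n * 2 ^ (2 * q) \<le> b (J n) * 2 ^ (2 * q)"
    unfolding b_def by (intro mult_right_mono a_J_ge) auto
  ultimately have "m n / 2 ^ n * 2 ^ (2 * q) - 5 * m n * 2 ^ q \<le> 2 ^ (2 * q) * K" by linarith
  moreover have "(2::real) ^ q = 16 * 2 ^ n"
    unfolding q_def power_add by simp
  then have "(2::real) ^ (2 * q) = 2 ^ q * (16 * 2 ^ n)"
    unfolding mult_2 power_add by (rule arg_cong)
  moreover have "m n / 2 ^ n * (2 ^ q * (16 * 2 ^ n)) = 2 ^ q * (16 * m n)"
    by simp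
  ultimately have "2 ^ q * (16 * m n) - 5 * m n * 2 ^ q \<le> 2 ^ q * (16 * 2 ^ n) * K"
    by (simp only:)
  then have "2 ^ q * (16 * m n - 5 * m n) \<le> 2 ^ q * (16 * 2 ^ n * K)"
    by (simp only: right_diff_distrib mult_ac)
  then have "16 * m n - 5 * m n \<le> 16 * 2 ^ n * K" by simp
  then show ?thesis using m_pos[of n] by linarith
qed

text \<open>A local bound on the derivatives and the lower bound \<open>g_lower_bound\<close>
  together would give \<open>dc_subset M N\<close>.\<close>

lemma g_notin_denjoy_carleman:
  assumes N: "weight_sequence N" "\<not> dc_subset M N" and U: "U \<noteq> {}"
  shows "(\<lambda>x. of_real (g 0 x) :: 'a :: real_normed_algebra_1) \<notin> denjoy_carleman N U"
proof
  assume "(\<lambda>x. of_real (g 0 x) :: 'a) \<in> denjoy_carleman N U"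
  then have "\<forall>x\<in>U. \<exists>V A B. open V \<and> V \<subseteq> U \<and> x \<in> V \<and> 0 < A \<and> 0 < B \<and>
      (\<forall>n. \<forall>y\<in>V. \<bar>g n y\<bar> \<le> A * B ^ n * fact n * N n)"
    unfolding denjoy_carleman_def mem_Collect_eq nth_derivative_g norm_of_real by (rule conjunct2)
  moreover obtain x where "x \<in> U" using U by blast
  ultimately obtain V A B where V: "open V" "x \<in> V" and AB: "0 < A" "0 < B"
    and bound: "\<And>n y. y \<in> V \<Longrightarrow> \<bar>g n y\<bar> \<le> A * B ^ n * fact n * N n"
    by (auto dest!: bspec)
  from V obtain d where d: "d > 0" "cball x d \<subseteq> V" by (auto simp: open_contains_cball)
  \<comment> \<open>Once \<open>M (Suc n) / M n > R\<close>, the interval required by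
    \<open>g_lower_bound\<close> has length at most \<open>d\<close>, since
    \<open>2 * n + 9 \<le> 9 * (n + 1)\<close> and \<open>mu n < 2 * 2 ^ J n\<close>.\<close>
  define R where "R = 18 * pi / d"
  have "R > 0" using d by (simp add: R_def)
  \<comment> \<open>Ratios bounded by \<open>R\<close> give \<open>M n \<le> R ^ n\<close>, the
    analytic case, and \<open>N n \<ge> 1\<close> then forces \<open>dc_subset M N\<close>.\<close>
  have "\<exists>n0. R < M (Suc n0) / M n0"
  proof (rule ccontr)
    assume "\<not> ?thesis"
    then have "M (Suc n) \<le> R * M n" for n
      by (simp add: not_less pos_divide_le_eq[OF M_pos])
    then have pow: "M n \<le> R ^ n" for n
    proof (induction n)
      case (Suc n)
      have "M (Suc n) \<le> R * M n" by (rule Suc.prems)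
      also have "\<dots> \<le> R * R ^ n"
        using Suc \<open>R > 0\<close> by (intro mult_left_mono) auto
      finally show ?case by simp
    qed (use weight_sequence in \<open>simp add: weight_sequence_def\<close>)
    have "M n \<le> 1 * R ^ n * N n" for n
    proof -
      have "R ^ n * 1 \<le> R ^ n * N n"
        using \<open>R > 0\<close> weight_sequence_ge_1[OF N(1)] by (intro mult_left_mono) auto
      with pow[of n] show ?thesis by simp
    qed
    then have "dc_subset M N"
      using \<open>R > 0\<close> by (intro dc_subsetI[OF weight_sequence N(1), of 1 R 0]) auto
    with N show False by simp
  qed
  then obtain n0 where n0: "R < M (Suc n0) / M n0" by blast
  have "M n \<le> 2 * A * (2 * B) ^ n * N n" if "n0 \<le> n" for n
  proof -
    have "R < M (Suc n) / M n"
      using n0 incseqD[OF ratio_incseq that] by linarith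
    then have "real (Suc n) * R < mu n"
      unfolding mu_def by (intro mult_strict_left_mono) auto
    also have "\<dots> < 2 * 2 ^ J n" using J_bounds(2)[of n] by simp
    finally have "9 * (n + 1) * pi < d * 2 ^ J n" using d by (simp add: R_def field_simps)
    moreover have "real (2 * n + 9) * pi \<le> 9 * (n + 1) * pi" by (intro mult_right_mono) auto
    ultimately have "real (2 * n + 9) * pi \<le> d * 2 ^ J n" by linarith
    then have "real (2 * n + 9) * (pi / 2 ^ J n) \<le> d"
      by (simp add: field_simps)
    then have "m n \<le> 2 * 2 ^ n * (A * B ^ n * fact n * N n)"
      using d(2) by (intro g_lower_bound[of x] bound) (auto simp: dist_real_def)
    then have "fact n * M n \<le> fact n * (2 * A * (2 * B) ^ n * N n)"
      by (simp add: m_def power_mult_distrib mult_ac)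
    then show ?thesis by simp
  qed
  then have "dc_subset M N"
    using AB by (intro dc_subsetI[OF weight_sequence N(1), of "2 * A" "2 * B" n0]) auto
  with N show False by simp
qed

end

theorem theorem1p1:
  fixes M :: "nat \<Rightarrow> real"
  assumes "weight_sequence M"
  shows
    "(\<exists>f :: real \<Rightarrow> real.
        f \<in> smooth_functions {-1<..<1} \<and>
        f \<in> denjoy_carleman M {-1<..<1} \<and>
        (\<forall>N U. weight_sequence N \<longrightarrow> dc_psubset N M \<longrightarrow>
           open U \<longrightarrow> U \<noteq> {} \<longrightarrow> U \<subseteq> {-1<..<1} \<longrightarrow> f \<notin> denjoy_carleman N U)) \<and>
     (\<exists>f :: real \<Rightarrow> complex.
        f \<in> smooth_functions {-1<..<1} \<and>
        f \<in> denjoy_carleman M {-1<..<1} \<and>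
        (\<forall>N U. weight_sequence N \<longrightarrow> dc_psubset N M \<longrightarrow>
           open U \<longrightarrow> U \<noteq> {} \<longrightarrow> U \<subseteq> {-1<..<1} \<longrightarrow> f \<notin> denjoy_carleman N U))"
proof -
  interpret weight M by unfold_locales (rule assms)
  show ?thesis
    \<comment> \<open>The same real series, embedded by \<open>of_real\<close>, is the witness over
      both fields.\<close>
    by (intro conjI; rule exI[of _ "\<lambda>x. of_real (g 0 x)"])
      (simp_all add: g_in_smooth_functions g_in_denjoy_carleman g_notin_denjoy_carleman
        dc_psubset_def del: of_real_eq_id)
qed

end
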